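(* Let $K \ge 2$, and for $Q \in \Delta_K^{(2)}$ let $\mathrm{EU}(Q) = I(Y, \Theta)$ be the mutual information of the outcome $Y$ and the first-order distribution $\Theta \sim Q$. Then there exist $Q, Q' \in \Delta_K^{(2)}$ such that $Q'$ is a spread-preserving location shift of $Q$ and property A5 is violated, i.e. $\mathrm{EU}(Q') \ne \mathrm{EU}(Q)$.
   Context: Let $\mathcal{Y} = \{y_1,\dots,y_K\}$ be a finite label space. The set of probability distributions on $\mathcal{Y}$ is identified with the simplex $\Delta_K = \{\theta = (\theta_1,\dots,\theta_K) \in [0,1]^K : \|\theta\|_1 = 1\}$, where $\theta_k = p(y_k \mid \theta)$. $\Delta_K^{(2)}$ denotes the set of (Borel) probability measures on $\Delta_K$ (second-order distributions). For $Q \in \Delta_K^{(2)}$, let $\Theta \sim Q$ and let $Y$ be the outcome with conditional distribution $p(\cdot \mid \theta)$ given $\Theta = \theta$, so its marginal is $p(y_k) = \int_{\Delta_K} \theta_k \, dQ(\theta)$. With logarithms in base 2 and $0 \log 0 = 0$: $H(Y) = -\sum_{y \in \mathcal{Y}} p(y) \log_2 p(y)$, $H(Y \mid \Theta) = \int_{\Delta_K} \left( -\sum_{k=1}^K \theta_k \log_2 \theta_k \right) dQ(\theta)$, $I(Y,\Theta) = H(Y) - H(Y \mid \Theta)$. Spread-preserving location shift: $Q'$ is a spread-preserving location shift of $Q$ if $Q$ and $Q'$ differ only in their respective means, i.e. $Q'$ is the image of $Q$ under a translation $\theta \mapsto \theta + c$ for some $c \in \mathbb{R}^K$ (with both $Q$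 and $Q'$ supported in $\Delta_K$). Property A5: if $Q'$ is a spread-preserving location shift of $Q$, then $\mathrm{EU}(Q') = \mathrm{EU}(Q)$. *)

theory Defs
  imports "HOL-Probability.Probability"
begin

text \<open>
  The label space is a finite type \<open>'k\<close> with \<open>K = CARD('k)\<close>; a first-order distribution is a
  vector \<open>\<theta> :: real ^ 'k\<close> whose component \<open>\<theta> $ y\<close> is the probability of label \<open>y\<close>.
\<close>

definition prob_simplex :: "(real ^ 'k::finite) set" where
  "prob_simplex = {\<theta>. (\<forall>y. \<theta> $ y \<in> {0..1}) \<and> (\<Sum>y\<in>UNIV. \<bar>\<theta> $ y\<bar>) = 1}"

definition second_order_distributions :: "(real ^ 'k::finite) measure set" where
  "second_order_distributions =
     {Q. prob_space Q \<and> sets Q = sets (restrict_space borel prob_simplex)}"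

definition outcome_distribution :: "(real ^ 'k::finite) measure \<Rightarrow> real ^ 'k" where
  "outcome_distribution Q = (\<chi> y. \<integral>\<theta>. \<theta> $ y \<partial>Q)"

text \<open>The convention \<open>0 log 0 = 0\<close> holds because \<open>0 * x = 0\<close> for every real \<open>x\<close>.\<close>

definition shannon_entropy :: "real ^ 'k::finite \<Rightarrow> real" where
  "shannon_entropy p = - (\<Sum>y\<in>UNIV. p $ y * log 2 (p $ y))"

definition outcome_entropy :: "(real ^ 'k::finite) measure \<Rightarrow> real" where
  "outcome_entropy Q = shannon_entropy (outcome_distribution Q)"

definition conditional_outcome_entropy :: "(real ^ 'k::finite) measure \<Rightarrow> real" where
  "conditional_outcome_entropy Q = (\<integral>\<theta>. shannon_entropy \<theta> \<partial>Q)"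

definition EU :: "(real ^ 'k::finite) measure \<Rightarrow> real" where
  "EU Q = outcome_entropy Q - conditional_outcome_entropy Q"

text \<open>
  A translation need not map the simplex into itself, so both measures are first pushed forward
  along the inclusion of the simplex into \<open>real ^ 'k\<close> and compared there.
\<close>

definition spread_preserving_location_shift ::
    "(real ^ 'k::finite) measure \<Rightarrow> (real ^ 'k) measure \<Rightarrow> bool" where
  "spread_preserving_location_shift Q Q' \<longleftrightarrow>
     (\<exists>c. distr Q' borel (\<lambda>\<theta>. \<theta>) = distr Q borel (\<lambda>\<theta>. \<theta> + c))"

end

theory Submission
  imports Defs
begin

text \<open>
  Put mass \<open>1/2\<close> on each of two points of an edge of the simplex. With \<open>h\<close> the binary entropy
  function, the pair of edge parameters \<open>0, 1/2\<close> has mutual information \<open>h (1/4) - 1/2\<close>, and its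
  shift by \<open>1/4\<close>, the pair \<open>1/4, 3/4\<close>, has \<open>1 - h (1/4)\<close>. As \<open>h (1/4) = 2 - 3/4 * log 2 3\<close>,
  these agree only if \<open>log 2 3 = 5/3\<close>, that is, only if \<open>27 = 32\<close>.
\<close>

text \<open>As a pushforward of a fair coin, integrals become two-term sums and shifts act on the
  coin's values. The target is the trace Borel algebra that
  \<open>second_order_distributions\<close> demands.\<close>

definition two_point :: "(real ^ 'k::finite) \<Rightarrow> real ^ 'k \<Rightarrow> (real ^ 'k) measure" where
  "two_point x y =
     distr (measure_pmf (bernoulli_pmf (1/2))) (restrict_space borel prob_simplex)
       (\<lambda>b. if b then x else y)"

text \<open>Every set of booleans is measurable for a pmf, so only the membership of both values in
  the simplex matters.\<close>

lemma measurable_two_point: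
  assumes "x \<in> prob_simplex" "y \<in> prob_simplex"
  shows "(\<lambda>b. if b then x else y) \<in>
    measure_pmf p \<rightarrow>\<^sub>M restrict_space borel prob_simplex"
  using assms by (auto simp: measurable_def space_restrict_space)

lemma two_point_in_second_order_distributions:
  assumes "x \<in> prob_simplex" "y \<in> prob_simplex"
  shows "two_point x y \<in> second_order_distributions"
  unfolding second_order_distributions_def two_point_def
  using measurable_two_point[OF assms]
  by (auto intro!: prob_space.prob_space_distr measure_pmf.prob_space_axioms)

lemma integral_two_point:
  fixes f :: "real ^ 'k::finite \<Rightarrow> real"
  assumes "x \<in> prob_simplex" "y \<in> prob_simplex" "f \<in> borel_measurable borel"
  shows "(\<integral>\<theta>. f \<theta> \<partial>two_point x y) = (f x + f y) / 2"
proof -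
  have "(\<integral>\<theta>. f \<theta> \<partial>two_point x y) =
      (\<integral>b. f (if b then x else y) \<partial>measure_pmf (bernoulli_pmf (1/2)))"
    unfolding two_point_def
    by (intro integral_distr measurable_two_point assms measurable_restrict_space1)
  also have "\<dots> = (f x + f y) / 2"
    by (subst integral_bernoulli_pmf) (auto simp: field_simps)
  finally show ?thesis .
qed

text \<open>Once pushed into the whole space, both sides are the law of the same function of the
  coin.\<close>

lemma two_point_location_shift:
  assumes "x \<in> prob_simplex" "y \<in> prob_simplex" "x + c \<in> prob_simplex" "y + c \<in> prob_simplex"
  shows "spread_preserving_location_shift (two_point x y) (two_point (x + c) (y + c))"
  unfolding spread_preserving_location_shift_def
proof
  have "distr (two_point (x + c) (y + c)) borel (\<lambda>\<theta>. \<theta>) =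
      distr (measure_pmf (bernoulli_pmf (1/2))) borel (\<lambda>b. if b then x + c else y + c)"
    unfolding two_point_def
    by (subst distr_distr[OF measurable_restrict_space1 measurable_two_point])
      (use assms in \<open>auto simp: comp_def\<close>)
  moreover have "distr (two_point x y) borel (\<lambda>\<theta>. \<theta> + c) =
      distr (measure_pmf (bernoulli_pmf (1/2))) borel (\<lambda>b. if b then x + c else y + c)"
    unfolding two_point_def
    by (subst distr_distr[OF measurable_restrict_space1 measurable_two_point])
      (use assms in \<open>auto simp: comp_def if_distrib[of "\<lambda>z. z + c"] cong: if_cong\<close>)
  ultimately show "distr (two_point (x + c) (y + c)) borel (\<lambda>\<theta>. \<theta>) =
      distr (two_point x y) borel (\<lambda>\<theta>. \<theta> + c)"
    by simp
qed

lemma borel_measurable_shannon_entropy: "shannon_entropy \<in> borel_measurable borel"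
  unfolding shannon_entropy_def[abs_def] by measurable

text \<open>The mean is the midpoint, so the mutual information is the Jensen gap of the entropy
  there.\<close>

lemma EU_two_point:
  assumes "x \<in> prob_simplex" "y \<in> prob_simplex"
  shows "EU (two_point x y) =
    shannon_entropy ((1/2) *\<^sub>R (x + y)) - (shannon_entropy x + shannon_entropy y) / 2"
proof -
  have "outcome_distribution (two_point x y) = (1/2) *\<^sub>R (x + y)"
    unfolding outcome_distribution_def using assms
    by (simp add: vec_eq_iff integral_two_point)
  then show ?thesis
    unfolding EU_def outcome_entropy_def conditional_outcome_entropy_def
    by (simp add: integral_two_point[OF assms borel_measurable_shannon_entropy])
qed

definition edge :: "'k::finite \<Rightarrow> 'k \<Rightarrow> real \<Rightarrow> real ^ 'k" where
  "edge a b t = t *\<^sub>R axis a 1 + (1 - t) *\<^sub>R axis b 1"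

text \<open>Labels other than \<open>a\<close> and \<open>b\<close> contribute
  \<open>g 0 = 0\<close>. Taking \<open>g\<close> as \<open>abs\<close> gives the normalization, and
  as \<open>p * log 2 p\<close> the entropy.\<close>

lemma sum_edge:
  fixes g :: "real \<Rightarrow> real"
  assumes "a \<noteq> b" "g 0 = 0"
  shows "(\<Sum>y\<in>UNIV. g (edge a b t $ y)) = g t + g (1 - t)"
proof -
  have "(\<Sum>y\<in>UNIV. g (edge a b t $ y)) = (\<Sum>y\<in>{a, b}. g (edge a b t $ y))"
    by (rule sum.mono_neutral_right) (auto simp: edge_def axis_def assms)
  also have "\<dots> = g t + g (1 - t)"
    using assms by (simp add: edge_def axis_def)
  finally show ?thesis .
qed

lemma edge_in_prob_simplex:
  assumes "a \<noteq> b" "0 \<le> t" "t \<le> 1"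
  shows "edge a b t \<in> prob_simplex"
  using assms sum_edge[of a b abs t]
  by (auto simp: prob_simplex_def edge_def axis_def)

lemma shannon_entropy_edge:
  assumes "a \<noteq> b"
  shows "shannon_entropy (edge a b t) = - (t * log 2 t + (1 - t) * log 2 (1 - t))"
  unfolding shannon_entropy_def using sum_edge[OF assms, of "\<lambda>p. p * log 2 p"] by simp

lemma edge_midpoint: "(1/2) *\<^sub>R (edge a b s + edge a b t) = edge a b ((s + t) / 2)"
  by (simp add: edge_def vec_eq_iff algebra_simps add_divide_distrib diff_divide_distrib)

lemma edge_shift: "edge a b s + t *\<^sub>R (axis a 1 - axis b 1) = edge a b (s + t)"
  by (simp add: edge_def algebra_simps)

lemma log_2_3_neq: "log 2 3 \<noteq> 5 / 3"
proof
  assume "log 2 3 = 5 / 3"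
  \<comment> \<open>Tripling clears the denominator: both sides equal 5.\<close>
  then have "log 2 (3 ^ 3) = log 2 (2 ^ 5)"
    by (simp only: log_nat_power) simp
  then show False
    by (subst (asm) log_inj[THEN inj_on_eq_iff]) auto
qed

theorem proposition3:
  assumes "CARD('k::finite) \<ge> 2"
  shows "\<exists>Q \<in> second_order_distributions. \<exists>Q' \<in> second_order_distributions.
    spread_preserving_location_shift (Q :: (real ^ 'k) measure) Q' \<and> EU Q' \<noteq> EU Q"
proof -
  obtain a b :: 'k where ab: "a \<noteq> b"
    using assms by (metis UNIV_I card_2_iff' card_le_Suc0_iff_eq finite not_less_eq_eq numeral_2_eq_2)
  let ?e = "edge a b"
  have simplex: "?e 0 \<in> prob_simplex" "?e (1/4) \<in> prob_simplex"
      "?e (1/2) \<in> prob_simplex" "?e (3/4) \<in> prob_simplex"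
    using ab by (simp_all add: edge_in_prob_simplex)
  have log4: "log 2 4 = (2::real)"
    using log_pow_cancel[of "2::real" 2] by simp
  \<comment> \<open>At parameters 1/4 and 3/4 the sum is
    \<open>1/4 * 2 + 3/4 * (2 - log 2 3)\<close>.\<close>
  have half: "shannon_entropy (?e (1/2)) = 1"
    and quarter: "shannon_entropy (?e (1/4)) = 2 - 3 / 4 * log 2 3"
    and three_quarters: "shannon_entropy (?e (3/4)) = 2 - 3 / 4 * log 2 3"
    and zero: "shannon_entropy (?e 0) = 0"
    by (simp_all add: shannon_entropy_edge[OF ab] log_divide log4 algebra_simps)
  \<comment> \<open>The midpoint has parameter 1/4, and the mean of the endpoint entropies 0 and 1
    is 1/2.\<close>
  have "EU (two_point (?e 0) (?e (1/2))) = 3 / 2 - 3 / 4 * log 2 3"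
    using simplex by (simp add: EU_two_point edge_midpoint quarter half zero del: scaleR_add_right)
  \<comment> \<open>Here the midpoint is the edge centre, of entropy 1, and both endpoints have
    equal entropy.\<close>
  moreover have "EU (two_point (?e (1/4)) (?e (3/4))) = 3 / 4 * log 2 3 - 1"
    using simplex
    by (simp add: EU_two_point edge_midpoint quarter half three_quarters field_simps
        del: scaleR_add_right)
  \<comment> \<open>Equality would mean \<open>3/2 * log 2 3 = 5/2\<close>.\<close>
  ultimately have "EU (two_point (?e (1/4)) (?e (3/4))) \<noteq> EU (two_point (?e 0) (?e (1/2)))"
    using log_2_3_neq by simp
  moreover have "spread_preserving_location_shift
      (two_point (?e 0) (?e (1/2))) (two_point (?e (1/4)) (?e (3/4)))"
    \<comment> \<open>The translation moves mass 1/4 from label \<open>b\<close> to label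
      \<open>a\<close>, adding 1/4 to the edge parameter.\<close>
    using two_point_location_shift[of "?e 0" "?e (1/2)" "(1/4) *\<^sub>R (axis a 1 - axis b 1)"] simplex
    by (simp add: edge_shift del: scaleR_diff_right)
  ultimately show ?thesis
    using two_point_in_second_order_distributions simplex by blast
qed

end
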